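(* Let $X$ be a flabby object in the effective topos $\mathrm{Eff}$. Let $f : X \to X$ be a morphism in $\mathrm{Eff}$. If $X$ is effective, then the statement "$f$ has a fixed point" holds in (the internal language of) the effective topos.
   Context: The effective topos $\mathrm{Eff}$ is Hyland's realizability topos over Kleene's first algebra: objects are sets $|X|$ equipped with a nonstandard equality predicate $[\![ x = x' ]\!] \subseteq \mathbb{N}$ (symmetric and transitive in the realizability sense), morphisms are equivalence classes of functional relations. Following Hyland's terminology, an object of $\mathrm{Eff}$ is effective if it is isomorphic to an object $(|X|, =)$ such that for all $x, x' \in |X|$, if $[\![ x = x ]\!] \cap [\![ x' = x' ]\!]$ is inhabited, then $x$ and $x'$ are identical elements of $|X|$. An object $X$ of an elementary topos $\mathcal{E}$ is flabby if and only if the statement "for any subset $K \subseteq X$ such that $\forall x,y \in K.\ x = y$, there exists an element $x \in X$ such that $K \subseteq \{x\}$" holds in the internal language of $\mathcal{E}$. Explicitly: for any monomorphism $K \to A$ and any morphism $K \to X$ in $\mathcal{E}$, there exist an epimorphism $B \to A$ and a morphism $B \to X$ such that the composite $K \times_A B \to B \to X$ equals the composite $K \times_A B \to K \to X$. The statement "$f$ has a fixed point" is the internal statement $\exists x \in X.\ f(x) = x$; it holds if and only if the equalizer of $f$ and $\mathrm{id}_X$ maps epimorphically onto the terminal object. *)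

theory Defs
  imports Main "HOL-Library.Nat_Bijection"
begin

section \<open>Kleene's first algebra\<close>

datatype recf =
    Zero
  | Succ
  | Proj nat
  | Comp recf "recf list"
  | PrimRec recf recf
  | Mu recf

text \<open>
  \<open>computes r xs y\<close>: the partial recursive function denoted by \<open>r\<close> is defined on the argument
  tuple \<open>xs\<close>, with value \<open>y\<close>. In \<open>PrimRec\<close> and \<open>Mu\<close> the first argument is the one that is
  recursed on or searched for.
\<close>

inductive computes :: "recf \<Rightarrow> nat list \<Rightarrow> nat \<Rightarrow> bool" where
  zero: "computes Zero xs 0"
| succ: "computes Succ [x] (Suc x)"
| proj: "i < length xs \<Longrightarrow> computes (Proj i) xs (xs ! i)"
| comp: "list_all2 (\<lambda>g y. computes g xs y) gs ys \<Longrightarrow> computes f ys z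
    \<Longrightarrow> computes (Comp f gs) xs z"
| rec_0: "computes f xs y \<Longrightarrow> computes (PrimRec f g) (0 # xs) y"
| rec_Suc: "computes (PrimRec f g) (n # xs) r \<Longrightarrow> computes g (n # r # xs) y
    \<Longrightarrow> computes (PrimRec f g) (Suc n # xs) y"
| mu: "computes f (n # xs) 0 \<Longrightarrow> (\<forall>i<n. \<exists>m>0. computes f (i # xs) m)
    \<Longrightarrow> computes (Mu f) xs n"

primrec recf_encode :: "recf \<Rightarrow> nat" where
  "recf_encode Zero = prod_encode (0, 0)"
| "recf_encode Succ = prod_encode (1, 0)"
| "recf_encode (Proj i) = prod_encode (2, i)"
| "recf_encode (Comp f gs) =
    prod_encode (3, prod_encode (recf_encode f, list_encode (map recf_encode gs)))"
| "recf_encode (PrimRec f g) = prod_encode (4, prod_encode (recf_encode f, recf_encode g))"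
| "recf_encode (Mu f) = prod_encode (5, recf_encode f)"

text \<open>
  \<open>kleene_app e n m\<close> is the statement that the application of \<open>e\<close> to \<open>n\<close> is defined and equals
  \<open>m\<close>. Numbers that do not code a program act as codes of the nowhere defined function.
\<close>

definition kleene_app :: "nat \<Rightarrow> nat \<Rightarrow> nat \<Rightarrow> bool" where
  "kleene_app e n m \<longleftrightarrow> (\<exists>r. e = recf_encode r \<and> computes r [n] m)"

lemma recf_encode_inject: "recf_encode r = recf_encode s \<Longrightarrow> r = s"
proof (induction r arbitrary: s)
  case (Comp f gs)
  then obtain f' gs' where s: "s = Comp f' gs'" by (cases s) simp_all
  have f: "recf_encode f = recf_encode f'" and gs: "map recf_encode gs = map recf_encode gs'"
    using Comp.prems by (simp_all add: s list_encode_eq)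
  have "gs = gs'"
  proof (rule nth_equalityI)
    show len: "length gs = length gs'" using gs by (rule map_eq_imp_length_eq)
    fix i assume i: "i < length gs"
    then have "recf_encode (gs ! i) = recf_encode (gs' ! i)" using gs len by (metis nth_map)
    with i show "gs ! i = gs' ! i" by (intro Comp.IH(2)) simp_all
  qed
  with Comp.IH(1)[OF f] s show ?case by simp
next
  case (Proj i) then show ?case by (cases s) simp_all
next
  case (PrimRec f g)
  then obtain f' g' where s: "s = PrimRec f' g'" by (cases s) simp_all
  with PrimRec show ?case by simp
next
  case (Mu f)
  then obtain f' where s: "s = Mu f'" by (cases s) simp_all
  with Mu show ?case by simp
next
  case Zero then show ?case by (cases s) simp_all
next
  case Succ then show ?case by (cases s) simp_all
qed

inductive_cases computes_cases:
  "computes Zero xs z" "computes Succ xs z" "computes (Proj i) xs z" "computes (Comp f gs) xs z"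
  "computes (PrimRec f g) (0 # xs) z" "computes (PrimRec f g) (Suc n # xs) z"
  "computes (Mu f) xs z"

lemma computes_deterministic: "computes r xs y \<Longrightarrow> computes r xs z \<Longrightarrow> y = z"
proof (induction arbitrary: z rule: computes.induct)
  case (comp xs gs ys f w)
  from comp.prems obtain ys' where ys': "list_all2 (\<lambda>g y. computes g xs y) gs ys'"
    "computes f ys' z" by (rule computes_cases(4))
  have "ys = ys'"
    using comp.IH(1) ys'(1) by (intro nth_equalityI) (simp_all add: list_all2_conv_all_nth)
  with comp.IH(2) ys'(2) show ?case by blast
next
  case (rec_Suc f g n xs r y)
  from rec_Suc.prems obtain r' where "computes (PrimRec f g) (n # xs) r'"
    "computes g (n # r' # xs) z" by (rule computes_cases(6))
  with rec_Suc.IH show ?case by blast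
next
  case (mu f n xs)
  from mu.prems have z: "computes f (z # xs) 0" "\<forall>i<z. \<exists>m>0. computes f (i # xs) m"
    by (blast elim: computes_cases(7))+
  have "\<not> n < z" using z(2) mu.IH(1) by (metis less_irrefl)
  moreover have "\<not> z < n" using z(1) mu.IH(2) by (metis less_irrefl)
  ultimately show ?case by simp
qed (blast elim: computes_cases)+

lemma kleene_app_deterministic: "kleene_app e n m \<Longrightarrow> kleene_app e n m' \<Longrightarrow> m = m'"
  unfolding kleene_app_def by (metis recf_encode_inject computes_deterministic)


section \<open>Realizability truth values\<close>

text \<open>A truth value is identified with its set of realizers.\<close>

definition r_and :: "nat set \<Rightarrow> nat set \<Rightarrow> nat set"  (infixr "\<^bold>\<and>" 65) where
  "P \<^bold>\<and> Q = {prod_encode (a, b) | a b. a \<in> P \<and> b \<in> Q}"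

definition r_imp :: "nat set \<Rightarrow> nat set \<Rightarrow> nat set"  (infixr "\<^bold>\<longrightarrow>" 60) where
  "P \<^bold>\<longrightarrow> Q = {e. \<forall>a\<in>P. \<exists>b\<in>Q. kleene_app e a b}"

definition r_iff :: "nat set \<Rightarrow> nat set \<Rightarrow> nat set"  (infixr "\<^bold>\<longleftrightarrow>" 60) where
  "(P \<^bold>\<longleftrightarrow> Q) = (P \<^bold>\<longrightarrow> Q) \<^bold>\<and> (Q \<^bold>\<longrightarrow> P)"

definition valid :: "nat set \<Rightarrow> bool" where
  "valid P \<longleftrightarrow> P \<noteq> {}"


section \<open>The effective topos\<close>

record 'a eff_obj =
  carrier :: "'a set"
  eqv :: "'a \<Rightarrow> 'a \<Rightarrow> nat set"

abbreviation ext :: "'a eff_obj \<Rightarrow> 'a \<Rightarrow> nat set" where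
  "ext X x \<equiv> eqv X x x"

definition eff_object :: "'a eff_obj \<Rightarrow> bool" where
  "eff_object X \<longleftrightarrow>
    valid (\<Inter>x\<in>carrier X. \<Inter>y\<in>carrier X. eqv X x y \<^bold>\<longrightarrow> eqv X y x) \<and>
    valid (\<Inter>x\<in>carrier X. \<Inter>y\<in>carrier X. \<Inter>z\<in>carrier X.
      eqv X x y \<^bold>\<and> eqv X y z \<^bold>\<longrightarrow> eqv X x z)"

text \<open>
  Functional relations: strict, extensional, single-valued and total. Values outside the carriers
  are irrelevant; relations that agree on the carriers are identified by \<open>fun_rel_equiv\<close>.
\<close>

definition functional_rel :: "'a eff_obj \<Rightarrow> 'b eff_obj \<Rightarrow> ('a \<Rightarrow> 'b \<Rightarrow> nat set) \<Rightarrow> bool" where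
  "functional_rel X Y F \<longleftrightarrow>
    valid (\<Inter>x\<in>carrier X. \<Inter>y\<in>carrier Y. F x y \<^bold>\<longrightarrow> ext X x \<^bold>\<and> ext Y y) \<and>
    valid (\<Inter>x\<in>carrier X. \<Inter>x'\<in>carrier X. \<Inter>y\<in>carrier Y. \<Inter>y'\<in>carrier Y.
      F x y \<^bold>\<and> eqv X x x' \<^bold>\<and> eqv Y y y' \<^bold>\<longrightarrow> F x' y') \<and>
    valid (\<Inter>x\<in>carrier X. \<Inter>y\<in>carrier Y. \<Inter>y'\<in>carrier Y. F x y \<^bold>\<and> F x y' \<^bold>\<longrightarrow> eqv Y y y') \<and>
    valid (\<Inter>x\<in>carrier X. ext X x \<^bold>\<longrightarrow> (\<Union>y\<in>carrier Y. F x y))"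

definition fun_rel_equiv ::
    "'a eff_obj \<Rightarrow> 'b eff_obj \<Rightarrow> (('a \<Rightarrow> 'b \<Rightarrow> nat set) \<times> ('a \<Rightarrow> 'b \<Rightarrow> nat set)) set" where
  "fun_rel_equiv X Y = {(F, G). functional_rel X Y F \<and> functional_rel X Y G \<and>
    valid (\<Inter>x\<in>carrier X. \<Inter>y\<in>carrier Y. F x y \<^bold>\<longleftrightarrow> G x y)}"

definition Hom :: "'a eff_obj \<Rightarrow> 'b eff_obj \<Rightarrow> ('a \<Rightarrow> 'b \<Rightarrow> nat set) set set" where
  "Hom X Y = {F. functional_rel X Y F} // fun_rel_equiv X Y"

definition eff_id :: "'a eff_obj \<Rightarrow> ('a \<Rightarrow> 'a \<Rightarrow> nat set) set" where
  "eff_id X = fun_rel_equiv X X `` {eqv X}"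

definition eff_comp :: "'a eff_obj \<Rightarrow> 'b eff_obj \<Rightarrow> 'c eff_obj \<Rightarrow>
    ('b \<Rightarrow> 'c \<Rightarrow> nat set) set \<Rightarrow> ('a \<Rightarrow> 'b \<Rightarrow> nat set) set \<Rightarrow> ('a \<Rightarrow> 'c \<Rightarrow> nat set) set" where
  "eff_comp X Y Z g f =
    (\<Union>G\<in>g. \<Union>F\<in>f. fun_rel_equiv X Z `` {\<lambda>x z. \<Union>y\<in>carrier Y. F x y \<^bold>\<and> G y z})"

definition eff_iso :: "'a eff_obj \<Rightarrow> 'b eff_obj \<Rightarrow> bool" where
  "eff_iso X Y \<longleftrightarrow> (\<exists>f\<in>Hom X Y. \<exists>g\<in>Hom Y X.
    eff_comp X Y X g f = eff_id X \<and> eff_comp Y X Y f g = eff_id Y)"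

text \<open>
  The existential quantifier over all objects isomorphic to \<open>X\<close> has to name the type of their
  elements; this type is a parameter. A theorem with the hypothesis
  \<open>effective TYPE('b) X\<close> for a type variable \<open>'b\<close> covers presentations with elements of any type.
\<close>

definition effective :: "'b itself \<Rightarrow> 'a eff_obj \<Rightarrow> bool" where
  "effective _ X \<longleftrightarrow> (\<exists>Y :: 'b eff_obj. eff_object Y \<and> eff_iso X Y \<and>
    (\<forall>y\<in>carrier Y. \<forall>y'\<in>carrier Y. ext Y y \<inter> ext Y y' \<noteq> {} \<longrightarrow> y = y'))"


section \<open>The internal language\<close>

text \<open>
  A formula is interpreted by its set of realizers; a closed formula holds in the internal
  language iff it has a realizer, i.e. iff its interpretation is \<^const>\<open>valid\<close>.
\<close>

definition All_in :: "'a eff_obj \<Rightarrow> ('a \<Rightarrow> nat set) \<Rightarrow> nat set" where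
  "All_in X \<phi> = (\<Inter>x\<in>carrier X. ext X x \<^bold>\<longrightarrow> \<phi> x)"

definition Ex_in :: "'a eff_obj \<Rightarrow> ('a \<Rightarrow> nat set) \<Rightarrow> nat set" where
  "Ex_in X \<phi> = (\<Union>x\<in>carrier X. ext X x \<^bold>\<and> \<phi> x)"

text \<open>
  The power object. Its elements are the predicates \<open>K\<close> on the carrier of \<open>X\<close>, here extended by
  \<open>{}\<close> outside the carrier; \<open>power_ext X K\<close> expresses that \<open>K\<close> is strict and extensional.
\<close>

definition power_ext :: "'a eff_obj \<Rightarrow> ('a \<Rightarrow> nat set) \<Rightarrow> nat set" where
  "power_ext X K =
    (\<Inter>x\<in>carrier X. K x \<^bold>\<longrightarrow> ext X x) \<^bold>\<and>
    (\<Inter>x\<in>carrier X. \<Inter>x'\<in>carrier X. K x \<^bold>\<and> eqv X x x' \<^bold>\<longrightarrow> K x')"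

definition power_obj :: "'a eff_obj \<Rightarrow> ('a \<Rightarrow> nat set) eff_obj" where
  "power_obj X =
    \<lparr>carrier = {K. \<forall>x. x \<notin> carrier X \<longrightarrow> K x = {}},
     eqv = (\<lambda>K L. power_ext X K \<^bold>\<and> (\<Inter>x\<in>carrier X. K x \<^bold>\<longleftrightarrow> L x))\<rparr>"

definition mem_in :: "'a eff_obj \<Rightarrow> 'a \<Rightarrow> ('a \<Rightarrow> nat set) \<Rightarrow> nat set" where
  "mem_in X x K = ext (power_obj X) K \<^bold>\<and> K x"

text \<open>
  The clause after the implication below is \<open>\<exists>x\<in>X. K \<subseteq> {x}\<close>, with the inclusion written out.
\<close>

definition flabby :: "'a eff_obj \<Rightarrow> bool" where
  "flabby X \<longleftrightarrow> valid (All_in (power_obj X) (\<lambda>K.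
     All_in X (\<lambda>x. All_in X (\<lambda>y. mem_in X x K \<^bold>\<and> mem_in X y K \<^bold>\<longrightarrow> eqv X x y))
     \<^bold>\<longrightarrow> Ex_in X (\<lambda>x. All_in X (\<lambda>y. mem_in X y K \<^bold>\<longrightarrow> eqv X y x))))"

text \<open>
  The formula \<open>f(x) = y\<close> is interpreted by any functional relation \<open>F\<close> representing \<open>f\<close>;
  equivalent functional relations yield the same validity.
\<close>

definition has_fixed_point :: "'a eff_obj \<Rightarrow> ('a \<Rightarrow> 'a \<Rightarrow> nat set) set \<Rightarrow> bool" where
  "has_fixed_point X f \<longleftrightarrow> (\<forall>F\<in>f. valid (Ex_in X (\<lambda>x. F x x)))"

end

theory Submission
  imports Defs
begin

text \<open>
  A flabby effective object has, up to its internal equality, exactly one element, and every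
  endomorphism fixes it.

  The reason is a uniformity phenomenon. For any two elements \<open>z\<close> and \<open>z'\<close> the numbers witnessing
  that \<open>{z}\<close> is a strict and extensional predicate with at most one element can be taken to be the
  same as those for \<open>{z'}\<close>: they express the transitivity and symmetry of equality and know nothing
  about \<open>z\<close>. The same numbers also serve for the empty predicate. A realizer of flabbiness sees only
  these numbers. On the empty predicate and on all singletons it therefore computes one and the same
  output, so that all these subsingletons are contained in sets \<open>{x}\<close> whose elements \<open>x\<close> share a
  realizer of their existence (\<open>flabby_uniform_filler\<close>).

  In an effective object, elements with a common existence realizer are equal. This is part of the
  definition for the disjoint presentation; it carries over to every isomorphic object up to internal
  equality, since functional relations and their composites are tracked by single programs
  (\<open>effective_common_realizer\<close>). Hence each \<open>z\<close> is equal to the element \<open>x\<close> that was found for the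
  empty predicate (\<open>flabby_effective_singleton\<close>). In particular the value of an endomorphism at \<open>x\<close>
  is equal to \<open>x\<close>.

  The computability needed is that of constants, composition, pairing and the two projections; it is
  packaged in a small calculus of entailments that are realized uniformly over a set of indices.
\<close>

section \<open>Computability of the pairing function\<close>

lemma computes_Comp1:
  "computes g xs y \<Longrightarrow> computes f [y] z \<Longrightarrow> computes (Comp f [g]) xs z"
  by (rule computes.comp[where ys = "[y]"]) simp_all

lemma computes_Comp2:
  "computes g xs y \<Longrightarrow> computes h xs y' \<Longrightarrow> computes f [y, y'] z
    \<Longrightarrow> computes (Comp f [g, h]) xs z"
  by (rule computes.comp[where ys = "[y, y']"]) simp_all

lemma computes_Proj: "i < length xs \<Longrightarrow> xs ! i = y \<Longrightarrow> computes (Proj i) xs y"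
  using computes.proj by blast

definition rf_add :: recf where
  "rf_add = PrimRec (Proj 0) (Comp Succ [Proj 1])"

lemma computes_add: "computes rf_add [m, n] (m + n)"
  unfolding rf_add_def
proof (induction m)
  case 0
  show ?case by (intro computes.rec_0 computes_Proj) simp_all
next
  case (Suc m)
  then show ?case
    by (rule computes.rec_Suc) (auto intro!: computes_Comp1 computes_Proj computes.succ)
qed

definition rf_pred :: recf where
  "rf_pred = PrimRec Zero (Proj 0)"

lemma computes_pred: "computes rf_pred [n] (n - 1)"
  unfolding rf_pred_def
proof (induction n)
  case 0
  show ?case by (auto intro: computes.intros)
next
  case (Suc n)
  then show ?case by (rule computes.rec_Suc) (simp add: computes_Proj)
qed

text \<open>Recursion runs on the first argument, so it is the subtrahend that comes first.\<close>

definition rf_monus :: recf where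
  "rf_monus = PrimRec (Proj 0) (Comp rf_pred [Proj 1])"

lemma computes_monus: "computes rf_monus [m, n] (n - m)"
  unfolding rf_monus_def
proof (induction m)
  case 0
  show ?case by (intro computes.rec_0 computes_Proj) simp_all
next
  case (Suc m)
  have "computes rf_pred [n - m] (n - Suc m)"
    using computes_pred[of "n - m"] by simp
  then have "computes (Comp rf_pred [Proj 1]) [m, n - m, n] (n - Suc m)"
    by (intro computes_Comp1 computes_Proj) simp_all
  with Suc show ?case by (rule computes.rec_Suc)
qed

definition rf_triangle :: recf where
  "rf_triangle = PrimRec Zero (Comp Succ [rf_add])"

lemma computes_triangle: "computes rf_triangle [n] (triangle n)"
  unfolding rf_triangle_def
proof (induction n)
  case 0
  show ?case by (auto intro: computes.rec_0 computes.zero)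
next
  case (Suc n)
  have "computes (Comp Succ [rf_add]) [n, triangle n] (triangle (Suc n))"
    using computes_Comp1[OF computes_add computes.succ, of n "triangle n"]
    by (simp add: add.commute)
  with Suc show ?case by (rule computes.rec_Suc)
qed

definition rf_pair :: recf where
  "rf_pair = Comp rf_add [Comp rf_triangle [rf_add], Proj 0]"

lemma computes_pair: "computes rf_pair [a, b] (prod_encode (a, b))"
  unfolding rf_pair_def prod_encode_def prod.case
  by (rule computes_Comp2[OF computes_Comp1[OF computes_add computes_triangle] _ computes_add])
    (simp add: computes_Proj)

text \<open>
  The code of a pair \<open>(a, b)\<close> lies on the diagonal \<open>a + b\<close> of the Cantor enumeration, between the
  triangular numbers \<open>triangle (a + b)\<close> and \<open>triangle (a + b + 1)\<close>. The diagonal is found by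
  unbounded search, and both components are computed from it.
\<close>

definition rf_diagonal :: recf where
  "rf_diagonal = Mu (Comp rf_monus [Comp rf_triangle [Comp Succ [Proj 0]], Comp Succ [Proj 1]])"

lemma triangle_mono: "m \<le> n \<Longrightarrow> triangle m \<le> triangle n"
  by (rule lift_Suc_mono_le[of triangle]) simp_all

lemma computes_diagonal: "computes rf_diagonal [prod_encode (a, b)] (a + b)"
proof -
  define p where "p = prod_encode (a, b)"
  let ?g = "Comp rf_monus [Comp rf_triangle [Comp Succ [Proj 0]], Comp Succ [Proj 1]]"
  have p: "p = triangle (a + b) + a" by (simp add: p_def prod_encode_def)
  have g: "computes ?g [k, p] (Suc p - triangle (Suc k))" for k
    by (intro computes_Comp2[OF _ _ computes_monus] computes_Comp1[OF _ computes_triangle]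
        computes_Comp1[OF _ computes.succ] computes_Proj) simp_all
  have "Suc p - triangle (Suc (a + b)) = 0" by (simp add: p)
  then have "computes ?g [a + b, p] 0" using g[of "a + b"] by metis
  moreover have "\<exists>m>0. computes ?g [i, p] m" if "i < a + b" for i
  proof -
    have "triangle (Suc i) \<le> p" using triangle_mono[of "Suc i" "a + b"] that p by linarith
    then have "Suc p - triangle (Suc i) > 0" by linarith
    with g show ?thesis by blast
  qed
  ultimately show ?thesis
    unfolding rf_diagonal_def p_def[symmetric] by (blast intro: computes.mu)
qed

definition rf_fst :: recf where
  "rf_fst = Comp rf_monus [Comp rf_triangle [rf_diagonal], Proj 0]"

lemma computes_fst: "computes rf_fst [prod_encode (a, b)] a"
proof -
  have "computes rf_fst [prod_encode (a, b)] (prod_encode (a, b) - triangle (a + b))"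
    unfolding rf_fst_def
    by (rule computes_Comp2[OF computes_Comp1[OF computes_diagonal computes_triangle]
          _ computes_monus]) (simp add: computes_Proj)
  then show ?thesis by (simp add: prod_encode_def)
qed

definition rf_snd :: recf where
  "rf_snd = Comp rf_monus [rf_fst, rf_diagonal]"

lemma computes_snd: "computes rf_snd [prod_encode (a, b)] b"
  using computes_Comp2[OF computes_fst computes_diagonal computes_monus, of a b]
  by (simp add: rf_snd_def)

fun rf_const :: "nat \<Rightarrow> recf" where
  "rf_const 0 = Zero"
| "rf_const (Suc n) = Comp Succ [rf_const n]"

lemma computes_const: "computes (rf_const n) xs n"
  by (induction n) (auto intro: computes.zero computes.succ computes_Comp1)

section \<open>Entailment between families of truth values\<close>

lemma r_and_I: "a \<in> P \<Longrightarrow> b \<in> Q \<Longrightarrow> prod_encode (a, b) \<in> P \<^bold>\<and> Q"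
  by (auto simp: r_and_def)

lemma r_and_E:
  assumes "c \<in> P \<^bold>\<and> Q"
  obtains a b where "c = prod_encode (a, b)" "a \<in> P" "b \<in> Q"
  using assms by (auto simp: r_and_def)

lemma r_and_empty_iff: "P \<^bold>\<and> Q = {} \<longleftrightarrow> P = {} \<or> Q = {}"
  by (auto simp: r_and_def)

lemma r_imp_E:
  assumes "e \<in> P \<^bold>\<longrightarrow> Q" "a \<in> P"
  obtains b where "kleene_app e a b" "b \<in> Q"
  using assms by (auto simp: r_imp_def)

lemma r_imp_nonempty: "e \<in> P \<^bold>\<longrightarrow> Q \<Longrightarrow> P \<noteq> {} \<Longrightarrow> Q \<noteq> {}"
  by (auto simp: r_imp_def)

text \<open>
  Entailment in the effective tripos over the index set \<open>I\<close>: one program works for all indices. The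
  nested intersections in the definitions of objects and functional relations are entailments over
  sets of tuples.
\<close>

definition entails :: "'i set \<Rightarrow> ('i \<Rightarrow> nat set) \<Rightarrow> ('i \<Rightarrow> nat set) \<Rightarrow> bool" where
  "entails I P Q \<longleftrightarrow> (\<exists>e. \<forall>i\<in>I. e \<in> P i \<^bold>\<longrightarrow> Q i)"

lemma entails_recf:
  assumes "\<And>i a. i \<in> I \<Longrightarrow> a \<in> P i \<Longrightarrow> \<exists>b\<in>Q i. computes r [a] b"
  shows "entails I P Q"
  unfolding entails_def r_imp_def kleene_app_def
  using assms by (intro exI[of _ "recf_encode r"]) blast

text \<open>
  The program can be chosen independently of the index because the coding of programs is injective;
  in this form entailments are combined by combining programs.
\<close>

lemma entailsD:
  assumes "entails I P Q"
  shows "\<exists>r. \<forall>i\<in>I. \<forall>a\<in>P i. \<exists>b\<in>Q i. computes r [a] b"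
proof -
  from assms obtain e where e: "\<And>i. i \<in> I \<Longrightarrow> e \<in> P i \<^bold>\<longrightarrow> Q i"
    unfolding entails_def by blast
  have "\<exists>b\<in>Q i. computes (THE r. e = recf_encode r) [a] b" if i: "i \<in> I" "a \<in> P i" for i a
  proof -
    obtain b r where r: "e = recf_encode r" "b \<in> Q i" "computes r [a] b"
      using e[OF i(1)] i(2) unfolding r_imp_def kleene_app_def by blast
    from r(1) have "(THE r. e = recf_encode r) = r"
      by (auto dest: recf_encode_inject)
    with r show ?thesis by auto
  qed
  then show ?thesis by blast
qed

lemma entails_nonempty: "entails I P Q \<Longrightarrow> i \<in> I \<Longrightarrow> P i \<noteq> {} \<Longrightarrow> Q i \<noteq> {}"
  unfolding entails_def using r_imp_nonempty by blast

text \<open>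
  Besides substitution of indices, this covers the adjunction of indices at which the premise has no
  realizer: the same number still realizes the entailment there.
\<close>

lemma entails_reindex:
  assumes "entails I P Q"
    and "\<And>j a. j \<in> J \<Longrightarrow> a \<in> P' j \<Longrightarrow> \<exists>i\<in>I. a \<in> P i \<and> Q i \<subseteq> Q' j"
  shows "entails J P' Q'"
  using assms unfolding entails_def r_imp_def by blast

lemma entails_refl: "entails I P P"
  by (rule entails_recf[where r = "Proj 0"]) (auto intro: computes_Proj)

lemma entails_trans:
  assumes "entails I P Q" "entails I Q R"
  shows "entails I P R"
proof -
  obtain r where r: "\<And>i a. i \<in> I \<Longrightarrow> a \<in> P i \<Longrightarrow> \<exists>b\<in>Q i. computes r [a] b"
    using entailsD[OF assms(1)] by blast
  obtain s where s: "\<And>i a. i \<in> I \<Longrightarrow> a \<in> Q i \<Longrightarrow> \<exists>b\<in>R i. computes s [a] b"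
    using entailsD[OF assms(2)] by blast
  show ?thesis
    by (rule entails_recf[where r = "Comp s [r]"]) (meson r s computes_Comp1)
qed

lemma entails_conjI:
  assumes "entails I P Q" "entails I P R"
  shows "entails I P (\<lambda>i. Q i \<^bold>\<and> R i)"
proof -
  obtain r where r: "\<And>i a. i \<in> I \<Longrightarrow> a \<in> P i \<Longrightarrow> \<exists>b\<in>Q i. computes r [a] b"
    using entailsD[OF assms(1)] by blast
  obtain s where s: "\<And>i a. i \<in> I \<Longrightarrow> a \<in> P i \<Longrightarrow> \<exists>b\<in>R i. computes s [a] b"
    using entailsD[OF assms(2)] by blast
  show ?thesis
    by (rule entails_recf[where r = "Comp rf_pair [r, s]"])
      (meson r s computes_Comp2 computes_pair r_and_I)
qed

lemma entails_conjD1: "entails I (\<lambda>i. P i \<^bold>\<and> Q i) P"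
  by (rule entails_recf[where r = rf_fst]) (auto elim!: r_and_E intro: computes_fst)

lemma entails_conjD2: "entails I (\<lambda>i. P i \<^bold>\<and> Q i) Q"
  by (rule entails_recf[where r = rf_snd]) (auto elim!: r_and_E intro: computes_snd)

text \<open>
  A realizer of the consequent yields one of the implication, whatever the antecedent is. This makes
  the bound variables of the internal statement "\<open>K\<close> has at most one element" harmless: its realizers
  can ignore the existence realizers of the two elements that are compared.
\<close>

lemma constant_realizer:
  "\<exists>e. \<forall>P Q. c \<in> Q \<longrightarrow> e \<in> P \<^bold>\<longrightarrow> Q"
  using computes_const unfolding r_imp_def kleene_app_def
  by (intro exI[of _ "recf_encode (rf_const c)"]) blast

section \<open>Objects of the effective topos\<close>

lemma eff_object_sym:
  assumes "eff_object X"
  shows "entails (carrier X \<times> carrier X) (\<lambda>(x, y). eqv X x y) (\<lambda>(x, y). eqv X y x)"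
  using assms unfolding eff_object_def valid_def entails_def ex_in_conv[symmetric] by simp

lemma eff_object_trans:
  assumes "eff_object X"
  shows "entails (carrier X \<times> carrier X \<times> carrier X)
    (\<lambda>(x, y, z). eqv X x y \<^bold>\<and> eqv X y z) (\<lambda>(x, y, z). eqv X x z)"
  using assms unfolding eff_object_def valid_def entails_def ex_in_conv[symmetric] by simp

lemma eqv_sym_nonempty:
  assumes "eff_object X" "x \<in> carrier X" "y \<in> carrier X" "eqv X x y \<noteq> {}"
  shows "eqv X y x \<noteq> {}"
  using entails_nonempty[OF eff_object_sym[OF assms(1)], of "(x, y)"] assms by simp

lemma eqv_trans_nonempty:
  assumes "eff_object X" "x \<in> carrier X" "y \<in> carrier X" "z \<in> carrier X"
    and "eqv X x y \<noteq> {}" "eqv X y z \<noteq> {}"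
  shows "eqv X x z \<noteq> {}"
  using entails_nonempty[OF eff_object_trans[OF assms(1)], of "(x, y, z)"] assms
  by (simp add: r_and_empty_iff)

text \<open>
  For fixed \<open>z\<close>, this says that the predicate \<open>eqv X z\<close> has at most one element; the realizer is the
  same for all \<open>z\<close>.
\<close>

lemma eqv_cotrans:
  assumes "eff_object X"
  shows "entails (carrier X \<times> carrier X \<times> carrier X)
    (\<lambda>(z, x, y). eqv X z x \<^bold>\<and> eqv X z y) (\<lambda>(z, x, y). eqv X x y)"
proof -
  let ?I = "carrier X \<times> carrier X \<times> carrier X"
  let ?P = "\<lambda>i. (case i of (z, x, y) \<Rightarrow> eqv X z x) \<^bold>\<and> (case i of (z, x, y) \<Rightarrow> eqv X z y)"
  have "entails ?I (\<lambda>(z, x, y). eqv X z x) (\<lambda>(z, x, y). eqv X x z)"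
    by (rule entails_reindex[OF eff_object_sym[OF assms]]) auto
  then have "entails ?I ?P (\<lambda>i. (case i of (z, x, y) \<Rightarrow> eqv X x z) \<^bold>\<and> (case i of (z, x, y) \<Rightarrow> eqv X z y))"
    by (intro entails_conjI entails_conjD2 entails_trans[OF entails_conjD1])
  moreover have "entails ?I (\<lambda>i. (case i of (z, x, y) \<Rightarrow> eqv X x z) \<^bold>\<and> (case i of (z, x, y) \<Rightarrow> eqv X z y))
      (\<lambda>(z, x, y). eqv X x y)"
    by (rule entails_reindex[OF eff_object_trans[OF assms]]) force
  ultimately have "entails ?I ?P (\<lambda>(z, x, y). eqv X x y)" by (rule entails_trans)
  then show ?thesis by (rule entails_reindex) force
qed

lemma eqv_strict:
  assumes "eff_object X"
  shows "entails (carrier X \<times> carrier X) (\<lambda>(z, x). eqv X z x) (\<lambda>(z, x). ext X x)"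
proof -
  let ?I = "carrier X \<times> carrier X"
  have "entails ?I (\<lambda>(z, x). eqv X z x)
      (\<lambda>i. (case i of (z, x) \<Rightarrow> eqv X z x) \<^bold>\<and> (case i of (z, x) \<Rightarrow> eqv X z x))"
    by (intro entails_conjI entails_refl)
  moreover have "entails ?I (\<lambda>i. (case i of (z, x) \<Rightarrow> eqv X z x) \<^bold>\<and> (case i of (z, x) \<Rightarrow> eqv X z x))
      (\<lambda>(z, x). ext X x)"
    by (rule entails_reindex[OF eqv_cotrans[OF assms]]) force
  ultimately show ?thesis by (rule entails_trans)
qed

lemma functional_rel_eqv:
  assumes X: "eff_object X"
  shows "functional_rel X X (eqv X)"
proof -
  let ?C = "carrier X"
  have strict: "entails (?C \<times> ?C) (\<lambda>(x, y). eqv X x y) (\<lambda>(x, y). ext X x \<^bold>\<and> ext X y)"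
  proof -
    have "entails (?C \<times> ?C) (\<lambda>(x, y). eqv X y x) (\<lambda>(x, y). ext X x)"
      by (rule entails_reindex[OF eqv_strict[OF X]]) auto
    then have "entails (?C \<times> ?C) (\<lambda>(x, y). eqv X x y) (\<lambda>(x, y). ext X x)"
      by (rule entails_trans[OF eff_object_sym[OF X]])
    from entails_conjI[OF this eqv_strict[OF X]] show ?thesis
      by (rule entails_reindex) force
  qed
  have extensional: "entails (?C \<times> ?C \<times> ?C \<times> ?C)
    (\<lambda>(x, x', y, y'). eqv X x y \<^bold>\<and> eqv X x x' \<^bold>\<and> eqv X y y') (\<lambda>(x, x', y, y'). eqv X x' y')"
  proof -
    let ?I = "?C \<times> ?C \<times> ?C \<times> ?C"
    let ?xy = "\<lambda>(x, x', y, y'). eqv X x y" and ?xx' = "\<lambda>(x, x', y, y'). eqv X x x'"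
      and ?yy' = "\<lambda>(x, x', y, y'). eqv X y y'" and ?x'y = "\<lambda>(x, x', y, y'). eqv X x' y"
    let ?P = "\<lambda>i. ?xy i \<^bold>\<and> ?xx' i \<^bold>\<and> ?yy' i"
    have xx': "entails ?I ?P ?xx'" and yy': "entails ?I ?P ?yy'"
      by (rule entails_trans[OF entails_conjD2], rule entails_conjD1 entails_conjD2)+
    have "entails ?I (\<lambda>i. ?xx' i \<^bold>\<and> ?xy i) ?x'y"
      by (rule entails_reindex[OF eqv_cotrans[OF X]]) force
    with entails_conjI[OF xx' entails_conjD1] have "entails ?I ?P ?x'y"
      by (rule entails_trans)
    from entails_conjI[OF this yy'] have "entails ?I ?P (\<lambda>i. ?x'y i \<^bold>\<and> ?yy' i)" .
    moreover have "entails ?I (\<lambda>i. ?x'y i \<^bold>\<and> ?yy' i) (\<lambda>(x, x', y, y'). eqv X x' y')"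
      by (rule entails_reindex[OF eff_object_trans[OF X]]) force
    ultimately have "entails ?I ?P (\<lambda>(x, x', y, y'). eqv X x' y')" by (rule entails_trans)
    then show ?thesis by (rule entails_reindex) force
  qed
  have total: "entails ?C (ext X) (\<lambda>x. \<Union>y\<in>?C. eqv X x y)"
    by (rule entails_reindex[OF entails_refl[of ?C "ext X"]]) auto
  show ?thesis
    using strict extensional eqv_cotrans[OF X] total
    unfolding functional_rel_def valid_def entails_def ex_in_conv[symmetric] by simp
qed

lemma eqv_in_eff_id:
  assumes "eff_object X"
  shows "eqv X \<in> eff_id X"
proof -
  obtain e where "\<And>P. e \<in> P \<^bold>\<longrightarrow> P"
    using entails_refl[of UNIV "\<lambda>P. P"] unfolding entails_def by auto
  then have "prod_encode (e, e) \<in> P \<^bold>\<longleftrightarrow> P" for P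
    by (simp add: r_iff_def r_and_I)
  then have "valid (\<Inter>x\<in>carrier X. \<Inter>y\<in>carrier X. eqv X x y \<^bold>\<longleftrightarrow> eqv X x y)"
    unfolding valid_def by blast
  then show ?thesis
    using functional_rel_eqv[OF assms] by (simp add: eff_id_def fun_rel_equiv_def)
qed

lemma Hom_functional_rel: "f \<in> Hom X Y \<Longrightarrow> F \<in> f \<Longrightarrow> functional_rel X Y F"
  by (auto simp: Hom_def quotient_def fun_rel_equiv_def)

lemma functional_rel_total:
  assumes "functional_rel X Y F"
  shows "\<exists>e. \<forall>x\<in>carrier X. \<forall>p\<in>ext X x. \<exists>u. kleene_app e p u \<and> (\<exists>y\<in>carrier Y. u \<in> F x y)"
proof -
  from assms have "\<exists>e. \<forall>x\<in>carrier X. e \<in> ext X x \<^bold>\<longrightarrow> (\<Union>y\<in>carrier Y. F x y)"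
    unfolding functional_rel_def valid_def ex_in_conv[symmetric] INT_iff by (elim conjE)
  then show ?thesis unfolding r_imp_def by (elim ex_forward) blast
qed

lemma functional_rel_cod:
  assumes "functional_rel X Y F"
  shows "\<exists>e. \<forall>x\<in>carrier X. \<forall>y\<in>carrier Y. \<forall>u\<in>F x y.
    \<exists>v. \<exists>r\<in>ext Y y. kleene_app e u (prod_encode (v, r))"
proof -
  from assms have "\<exists>e. \<forall>x\<in>carrier X. \<forall>y\<in>carrier Y. e \<in> F x y \<^bold>\<longrightarrow> ext X x \<^bold>\<and> ext Y y"
    unfolding functional_rel_def valid_def ex_in_conv[symmetric] INT_iff by (elim conjE)
  then show ?thesis unfolding r_imp_def r_and_def by (elim ex_forward) blast
qed

text \<open>
  Only inhabitedness is recorded here, as the validity of an existential statement asks for one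
  element and not for uniform realizers.
\<close>

lemma functional_rel_extensional:
  assumes F: "functional_rel X Y F"
    and carriers: "x \<in> carrier X" "x' \<in> carrier X" "y \<in> carrier Y" "y' \<in> carrier Y"
    and nonempty: "F x y \<noteq> {}" "eqv X x x' \<noteq> {}" "eqv Y y y' \<noteq> {}"
  shows "F x' y' \<noteq> {}"
proof -
  from F have "\<exists>e. \<forall>x\<in>carrier X. \<forall>x'\<in>carrier X. \<forall>y\<in>carrier Y. \<forall>y'\<in>carrier Y.
      e \<in> F x y \<^bold>\<and> eqv X x x' \<^bold>\<and> eqv Y y y' \<^bold>\<longrightarrow> F x' y'"
    unfolding functional_rel_def valid_def ex_in_conv[symmetric] INT_iff by (elim conjE)
  then obtain e where "e \<in> F x y \<^bold>\<and> eqv X x x' \<^bold>\<and> eqv Y y y' \<^bold>\<longrightarrow> F x' y'"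
    using carriers by meson
  then show ?thesis
    by (rule r_imp_nonempty) (simp add: r_and_empty_iff nonempty)
qed

text \<open>
  The form of effectivity that is invariant under isomorphism. The realizers of totality of the two
  relations \<open>F\<close> and \<open>G\<close> of an isomorphism act on the number \<open>p\<close> alone, so \<open>x\<close> and \<open>x'\<close> are sent to
  elements of the disjoint presentation with a common existence realizer. These elements coincide,
  and the way back leads from both \<open>x\<close> and \<open>x'\<close> to the same element.
\<close>

lemma effective_common_realizer:
  assumes X: "eff_object X" and eff: "effective TYPE('b) X"
    and x: "x \<in> carrier X" and x': "x' \<in> carrier X"
    and p: "p \<in> ext X x" and p': "p \<in> ext X x'"
  shows "eqv X x x' \<noteq> {}"
proof -
  obtain Y :: "'b eff_obj" and f g where Y:
      "\<And>y y'. y \<in> carrier Y \<Longrightarrow> y' \<in> carrier Y \<Longrightarrow> ext Y y \<inter> ext Y y' \<noteq> {} \<Longrightarrow> y = y'"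
    and f: "f \<in> Hom X Y" and g: "g \<in> Hom Y X" and gf: "eff_comp X Y X g f = eff_id X"
    using eff unfolding effective_def eff_iso_def by blast
  from eqv_in_eff_id[OF X] gf obtain F G where F: "F \<in> f" and G: "G \<in> g"
    and "(\<lambda>x z. \<Union>y\<in>carrier Y. F x y \<^bold>\<and> G y z, eqv X) \<in> fun_rel_equiv X X"
    unfolding eff_comp_def by blast
  then have "\<exists>w. \<forall>x\<in>carrier X. \<forall>z\<in>carrier X.
      w \<in> (\<Union>y\<in>carrier Y. F x y \<^bold>\<and> G y z) \<^bold>\<longleftrightarrow> eqv X x z"
    by (simp add: fun_rel_equiv_def valid_def ex_in_conv[symmetric])
  then obtain w where w: "\<And>x z. x \<in> carrier X \<Longrightarrow> z \<in> carrier X \<Longrightarrow>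
      w \<in> (\<Union>y\<in>carrier Y. F x y \<^bold>\<and> G y z) \<^bold>\<longleftrightarrow> eqv X x z"
    by blast
  have comp: "eqv X x z \<noteq> {}"
    if "x \<in> carrier X" "z \<in> carrier X" "y \<in> carrier Y" "F x y \<noteq> {}" "G y z \<noteq> {}" for x y z
  proof -
    from w[OF \<open>x \<in> carrier X\<close> \<open>z \<in> carrier X\<close>] obtain e where "e \<in> (\<Union>y\<in>carrier Y. F x y \<^bold>\<and> G y z) \<^bold>\<longrightarrow> eqv X x z"
      unfolding r_iff_def by (blast elim: r_and_E)
    moreover have "(\<Union>y\<in>carrier Y. F x y \<^bold>\<and> G y z) \<noteq> {}"
      using that(3-5) by (auto simp: r_and_empty_iff)
    ultimately show ?thesis by (rule r_imp_nonempty)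
  qed
  note F = Hom_functional_rel[OF f F] and G = Hom_functional_rel[OF g G]
  obtain t where t: "\<And>x p. x \<in> carrier X \<Longrightarrow> p \<in> ext X x
      \<Longrightarrow> \<exists>u. kleene_app t p u \<and> (\<exists>y\<in>carrier Y. u \<in> F x y)"
    using functional_rel_total[OF F] by blast
  obtain s where s: "\<And>x y u. x \<in> carrier X \<Longrightarrow> y \<in> carrier Y \<Longrightarrow> u \<in> F x y
      \<Longrightarrow> \<exists>v. \<exists>r\<in>ext Y y. kleene_app s u (prod_encode (v, r))"
    using functional_rel_cod[OF F] by blast
  \<comment> \<open>The number \<open>u\<close> depends only on \<open>p\<close>, and \<open>r\<close> only on \<open>u\<close>; hence \<open>r\<close> realizes the existence of both images.\<close>
  from t[OF x p] obtain u y where u: "kleene_app t p u" and y: "y \<in> carrier Y" "u \<in> F x y"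
    by blast
  from t[OF x' p'] u obtain y' where y': "y' \<in> carrier Y" "u \<in> F x' y'"
    using kleene_app_deterministic by blast
  from s[OF x y] obtain v r where r: "kleene_app s u (prod_encode (v, r))" "r \<in> ext Y y"
    by blast
  from s[OF x' y'] obtain v' r' where "kleene_app s u (prod_encode (v', r'))" "r' \<in> ext Y y'"
    by blast
  moreover from this r(1) have "prod_encode (v, r) = prod_encode (v', r')"
    using kleene_app_deterministic by blast
  ultimately have "r \<in> ext Y y'" by (simp add: prod_encode_eq)
  with r(2) Y[OF y(1) y'(1)] have yy': "y = y'" by blast
  obtain z where z: "z \<in> carrier X" "G y z \<noteq> {}"
    using functional_rel_total[OF G] y(1) r(2) by blast
  have xz: "eqv X x z \<noteq> {}" using comp[OF x z(1) y(1) _ z(2)] y(2) by blast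
  have "eqv X x' z \<noteq> {}" using comp[OF x' z(1) y(1) _ z(2)] y'(2) yy' by blast
  then have "eqv X z x' \<noteq> {}" by (rule eqv_sym_nonempty[OF X x' z(1)])
  with xz show ?thesis by (rule eqv_trans_nonempty[OF X x z(1) x'])
qed

section \<open>Flabby objects\<close>

lemma All_in_nonempty:
  "v \<in> All_in X \<phi> \<Longrightarrow> x \<in> carrier X \<Longrightarrow> ext X x \<noteq> {} \<Longrightarrow> \<phi> x \<noteq> {}"
  unfolding All_in_def using r_imp_nonempty by blast

text \<open>
  If a family of predicates shares its realizers of strictness, extensionality and having at most one
  element, then its members are indistinguishable to a realizer of flabbiness, which therefore
  returns the same number \<open>p\<close> as witness for all of them. The containing elements \<open>x\<close> themselves
  still depend on \<open>K\<close>.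
\<close>

lemma flabby_uniform_filler:
  assumes flabby: "flabby X"
    and \<K>: "\<K> \<subseteq> carrier (power_obj X)"
    and strict: "entails (\<K> \<times> carrier X) (\<lambda>(K, x). K x) (\<lambda>(K, x). ext X x)"
    and extensional: "entails (\<K> \<times> carrier X \<times> carrier X)
      (\<lambda>(K, x, y). K x \<^bold>\<and> eqv X x y) (\<lambda>(K, x, y). K y)"
    and subsingleton: "entails (\<K> \<times> carrier X \<times> carrier X)
      (\<lambda>(K, x, y). K x \<^bold>\<and> K y) (\<lambda>(K, x, y). eqv X x y)"
  shows "\<exists>p. \<forall>K\<in>\<K>. \<exists>x\<in>carrier X. p \<in> ext X x \<and>
    (\<forall>y\<in>carrier X. K y \<noteq> {} \<longrightarrow> eqv X y x \<noteq> {})"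
proof -
  let ?sub = "\<lambda>K. All_in X (\<lambda>x. All_in X (\<lambda>y. mem_in X x K \<^bold>\<and> mem_in X y K \<^bold>\<longrightarrow> eqv X x y))"
  let ?filler = "\<lambda>K x. All_in X (\<lambda>y. mem_in X y K \<^bold>\<longrightarrow> eqv X y x)"

  \<comment> \<open>A common realizer \<open>a\<close> of the existence of all members of \<open>\<K>\<close> in the power object; reflexivity of \<open>\<longleftrightarrow>\<close> accounts for its second half.\<close>
  obtain s where s: "\<And>K x. K \<in> \<K> \<Longrightarrow> x \<in> carrier X \<Longrightarrow> s \<in> K x \<^bold>\<longrightarrow> ext X x"
    using strict unfolding entails_def by auto
  obtain t where t: "\<And>K x y. K \<in> \<K> \<Longrightarrow> x \<in> carrier X \<Longrightarrow> y \<in> carrier X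
      \<Longrightarrow> t \<in> K x \<^bold>\<and> eqv X x y \<^bold>\<longrightarrow> K y"
    using extensional unfolding entails_def by auto
  obtain i where i: "\<And>P. i \<in> P \<^bold>\<longrightarrow> P"
    using entails_refl[of UNIV "\<lambda>P. P"] unfolding entails_def by auto
  define a where "a = prod_encode (prod_encode (s, t), prod_encode (i, i))"
  have a: "a \<in> ext (power_obj X) K" if "K \<in> \<K>" for K
    unfolding a_def power_obj_def power_ext_def r_iff_def
    using s[OF that] t[OF that] i by (auto intro!: r_and_I)

  \<comment> \<open>A common realizer \<open>c\<close> of the statement that a member of \<open>\<K>\<close> has at most one element.\<close>
  have "entails (\<K> \<times> carrier X \<times> carrier X)
      (\<lambda>(K, x, y). mem_in X x K \<^bold>\<and> mem_in X y K) (\<lambda>(K, x, y). K x \<^bold>\<and> K y)"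
    (is "entails ?I _ _")
  proof -
    have 1: "entails ?I (\<lambda>i. (case i of (K, x, y) \<Rightarrow> mem_in X x K)) (\<lambda>(K, x, y). K x)"
      by (rule entails_reindex[OF entails_conjD2[of UNIV "\<lambda>(P, Q). P" "\<lambda>(P, Q). Q"]])
        (auto simp: mem_in_def)
    have 2: "entails ?I (\<lambda>i. (case i of (K, x, y) \<Rightarrow> mem_in X y K)) (\<lambda>(K, x, y). K y)"
      by (rule entails_reindex[OF entails_conjD2[of UNIV "\<lambda>(P, Q). P" "\<lambda>(P, Q). Q"]])
        (auto simp: mem_in_def)
    from entails_conjI[OF entails_trans[OF entails_conjD1 1] entails_trans[OF entails_conjD2 2]]
    show ?thesis by (rule entails_reindex) force
  qed
  from entails_trans[OF this subsingleton] obtain e where e: "\<And>K x y. K \<in> \<K> \<Longrightarrow>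
      x \<in> carrier X \<Longrightarrow> y \<in> carrier X \<Longrightarrow> e \<in> mem_in X x K \<^bold>\<and> mem_in X y K \<^bold>\<longrightarrow> eqv X x y"
    unfolding entails_def by auto
  obtain e' where e': "\<And>P Q. e \<in> Q \<Longrightarrow> e' \<in> P \<^bold>\<longrightarrow> Q" using constant_realizer by blast
  obtain c where c: "\<And>P Q. e' \<in> Q \<Longrightarrow> c \<in> P \<^bold>\<longrightarrow> Q" using constant_realizer by blast
  have c: "c \<in> ?sub K" if "K \<in> \<K>" for K
    unfolding All_in_def using e[OF that] by (auto intro!: c e')

  \<comment> \<open>The output \<open>d\<close> of flabbiness on \<open>a\<close> and \<open>c\<close> does not mention \<open>K\<close>; its first component is the witness.\<close>
  obtain \<Phi> where \<Phi>: "\<Phi> \<in> All_in (power_obj X) (\<lambda>K. ?sub K \<^bold>\<longrightarrow> Ex_in X (?filler K))"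
    using flabby unfolding flabby_def valid_def by blast
  define d where "d = (THE d. \<exists>b. kleene_app \<Phi> a b \<and> kleene_app b c d)"
  have d: "d \<in> Ex_in X (?filler K)" if K: "K \<in> \<K>" for K
  proof -
    have "\<Phi> \<in> ext (power_obj X) K \<^bold>\<longrightarrow> (?sub K \<^bold>\<longrightarrow> Ex_in X (?filler K))"
      using \<Phi> K \<K> unfolding All_in_def by blast
    then obtain b where b: "kleene_app \<Phi> a b" "b \<in> ?sub K \<^bold>\<longrightarrow> Ex_in X (?filler K)"
      using a[OF K] by (rule r_imp_E)
    from this(2) c[OF K] obtain d' where d': "kleene_app b c d'" "d' \<in> Ex_in X (?filler K)"
      by (rule r_imp_E)
    have "d = d'"
      unfolding d_def using b(1) d'(1) by (blast dest: kleene_app_deterministic)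
    with d' show ?thesis by simp
  qed

  show ?thesis
  proof (intro exI ballI)
    fix K assume K: "K \<in> \<K>"
    from d[OF K] obtain x p v where x: "x \<in> carrier X" "p \<in> ext X x" "v \<in> ?filler K x"
      and dpv: "d = prod_encode (p, v)"
      unfolding Ex_in_def r_and_def by blast
    have "eqv X y x \<noteq> {}" if y: "y \<in> carrier X" "K y \<noteq> {}" for y
    proof -
      have "ext X y \<noteq> {}" using r_imp_nonempty[OF s[OF K y(1)] y(2)] .
      from All_in_nonempty[OF x(3) y(1) this]
      have "(mem_in X y K \<^bold>\<longrightarrow> eqv X y x) \<noteq> {}" .
      moreover have "mem_in X y K \<noteq> {}"
        using a[OF K] y(2) by (auto simp: mem_in_def r_and_empty_iff)
      ultimately show ?thesis using r_imp_nonempty by blast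
    qed
    with x dpv show "\<exists>x\<in>carrier X. fst (prod_decode d) \<in> ext X x \<and>
        (\<forall>y\<in>carrier X. K y \<noteq> {} \<longrightarrow> eqv X y x \<noteq> {})"
      by auto
  qed
qed

text \<open>
  Predicates in the power object are required to vanish outside the carrier.
\<close>

definition singleton_pred :: "'a eff_obj \<Rightarrow> 'a \<Rightarrow> 'a \<Rightarrow> nat set" where
  "singleton_pred X z = (\<lambda>x. if x \<in> carrier X then eqv X z x else {})"

text \<open>
  The family consisting of all singletons has shared realizers, and so has its extension by the empty
  predicate, for which every number realizes the required implications. The empty predicate provides
  an element \<open>x\<close> to start with; the element found for \<open>{z}\<close> equals \<open>z\<close> by flabbiness and \<open>x\<close> by
  effectivity.
\<close>

lemma flabby_effective_singleton:
  assumes X: "eff_object X" and flabby: "flabby X" and eff: "effective TYPE('b) X"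
  obtains x where "x \<in> carrier X" "ext X x \<noteq> {}"
    "\<And>z. z \<in> carrier X \<Longrightarrow> ext X z \<noteq> {} \<Longrightarrow> eqv X z x \<noteq> {}"
proof -
  let ?\<K> = "insert (\<lambda>_. {}) (singleton_pred X ` carrier X)"
  have "?\<K> \<subseteq> carrier (power_obj X)"
    by (auto simp: power_obj_def singleton_pred_def)
  moreover have "entails (?\<K> \<times> carrier X) (\<lambda>(K, x). K x) (\<lambda>(K, x). ext X x)"
    by (rule entails_reindex[OF eqv_strict[OF X]]) (force simp: singleton_pred_def split: if_splits)
  moreover have "entails (?\<K> \<times> carrier X \<times> carrier X)
      (\<lambda>(K, x, y). K x \<^bold>\<and> eqv X x y) (\<lambda>(K, x, y). K y)"
    by (rule entails_reindex[OF eff_object_trans[OF X]])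
      (force simp: singleton_pred_def r_and_def)
  moreover have "entails (?\<K> \<times> carrier X \<times> carrier X)
      (\<lambda>(K, x, y). K x \<^bold>\<and> K y) (\<lambda>(K, x, y). eqv X x y)"
    by (rule entails_reindex[OF eqv_cotrans[OF X]])
      (force simp: singleton_pred_def r_and_def)
  ultimately have "\<exists>p. \<forall>K\<in>?\<K>. \<exists>x\<in>carrier X. p \<in> ext X x \<and>
      (\<forall>y\<in>carrier X. K y \<noteq> {} \<longrightarrow> eqv X y x \<noteq> {})"
    by (rule flabby_uniform_filler[OF flabby])
  then obtain p where p: "\<forall>K\<in>?\<K>. \<exists>x\<in>carrier X. p \<in> ext X x \<and>
      (\<forall>y\<in>carrier X. K y \<noteq> {} \<longrightarrow> eqv X y x \<noteq> {})" ..
  from bspec[OF p, of "\<lambda>_. {}"] obtain x where x: "x \<in> carrier X" "p \<in> ext X x" by blast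
  show ?thesis
  proof (rule that[OF x(1)])
    show "ext X x \<noteq> {}" using x(2) by blast
    fix z assume z: "z \<in> carrier X" "ext X z \<noteq> {}"
    then have "singleton_pred X z z \<noteq> {}" by (simp add: singleton_pred_def)
    with bspec[OF p, of "singleton_pred X z"] z(1) obtain x' where x': "x' \<in> carrier X" "p \<in> ext X x'"
      and "eqv X z x' \<noteq> {}" by blast
    moreover have "eqv X x' x \<noteq> {}"
      by (rule effective_common_realizer[OF X eff x'(1) x(1) x'(2) x(2)])
    ultimately show "eqv X z x \<noteq> {}"
      using eqv_trans_nonempty[OF X z(1) x'(1) x(1)] by blast
  qed
qed

section \<open>Fixed points\<close>

theorem proposition5p1:
  fixes X :: "'a eff_obj" and f :: "('a \<Rightarrow> 'a \<Rightarrow> nat set) set"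
  assumes "eff_object X"
    and "flabby X"
    and "f \<in> Hom X X"
    and "effective TYPE('b) X"
  shows "has_fixed_point X f"
  unfolding has_fixed_point_def
proof
  fix F assume "F \<in> f"
  with assms(3) have F: "functional_rel X X F" by (rule Hom_functional_rel)
  obtain x where x: "x \<in> carrier X" "ext X x \<noteq> {}"
    and only: "\<And>z. z \<in> carrier X \<Longrightarrow> ext X z \<noteq> {} \<Longrightarrow> eqv X z x \<noteq> {}"
    using flabby_effective_singleton[OF assms(1,2,4)] by blast
  obtain y where y: "y \<in> carrier X" "F x y \<noteq> {}"
    using functional_rel_total[OF F] x by blast
  have "ext X y \<noteq> {}"
    using functional_rel_cod[OF F] x(1) y by blast
  then have yx: "eqv X y x \<noteq> {}" by (rule only[OF y(1)])
  have "F x x \<noteq> {}"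
    using functional_rel_extensional[OF F x(1) x(1) y(1) x(1) y(2) x(2) yx] .
  then have "ext X x \<^bold>\<and> F x x \<noteq> {}" using x(2) by (simp add: r_and_empty_iff)
  then show "valid (Ex_in X (\<lambda>x. F x x))"
    unfolding valid_def Ex_in_def using x(1) by blast
qed

end
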